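(* Every weighted dual skeleton $(Z,\sigma,\kappa)$ admits at least one complete spectral duality structure; that is, there exist $N$ and functions $A_1,\dots,A_N:Z\to\mathbb R$ such that $\bigl((Z,\sigma,\kappa),\{A_\nu\}_{\nu=1}^N\bigr)$ is a complete spectral duality structure. In particular, the existence of full-rank amplitudes imposes no additional restriction on the class of weighted dual skeletons.
   Context: A weighted dual skeleton is a triple $(Z,\sigma,\kappa)$ where $Z$ is a non-empty finite set, $\sigma:Z\to Z$ satisfies $\sigma^2=\mathrm{id}$, and $\kappa:Z\to\mathbb R_{>0}$ satisfies $\kappa(z)\kappa(\sigma(z))=K$ for all $z\in Z$, with $K>0$ constant. A complete spectral duality structure is a pair consisting of a weighted dual skeleton $(Z,\sigma,\kappa)$ and a family of functions $A_\nu:Z\to\mathbb R$, $\nu=1,\dots,N$ (amplitudes), such that the $|Z|$ vectors $\mathbf A(z)=(A_1(z),\dots,A_N(z))$, $z\in Z$, are linearly independent in $\mathbb R^N$ (full-rank condition). The amplitudes define the dual functions by $B_\nu(z)=\kappa(z)A_\nu(\sigma(z))$. *)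

theory Defs
  imports "Jordan_Normal_Form.VS_Connect"
begin

locale weighted_dual_skeleton =
  fixes Z :: "'a set" and \<sigma> :: "'a \<Rightarrow> 'a" and \<kappa> :: "'a \<Rightarrow> real"
  assumes finite_Z: "finite Z"
    and nonempty_Z: "Z \<noteq> {}"
    and \<sigma>_closed: "\<And>z. z \<in> Z \<Longrightarrow> \<sigma> z \<in> Z"
    and \<sigma>_involution: "\<And>z. z \<in> Z \<Longrightarrow> \<sigma> (\<sigma> z) = z"
    and \<kappa>_pos: "\<And>z. z \<in> Z \<Longrightarrow> \<kappa> z > 0"
    and \<kappa>_duality: "\<exists>K>0. \<forall>z\<in>Z. \<kappa> z * \<kappa> (\<sigma> z) = K"

text \<open>The amplitudes are indexed by \<open>1, \<dots>, N\<close>, whereas the components of a vector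
  in \<open>carrier_vec N\<close> are indexed by \<open>0, \<dots>, N - 1\<close>.\<close>

definition amplitude_vec :: "nat \<Rightarrow> (nat \<Rightarrow> 'a \<Rightarrow> real) \<Rightarrow> 'a \<Rightarrow> real vec" where
  "amplitude_vec N A z = vec N (\<lambda>i. A (Suc i) z)"

text \<open>The full-rank condition concerns the family \<open>amplitude_vec N A z\<close> indexed by \<open>z \<in> Z\<close>.
  As \<open>lin_dep\<close> is a predicate on sets of vectors, injectivity has to be required in addition:
  a family with a repeated vector is linearly dependent.\<close>

locale complete_spectral_duality_structure = weighted_dual_skeleton Z \<sigma> \<kappa>
  for Z :: "'a set" and \<sigma> :: "'a \<Rightarrow> 'a" and \<kappa> :: "'a \<Rightarrow> real" +
  fixes N :: nat and A :: "nat \<Rightarrow> 'a \<Rightarrow> real"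
  assumes amplitude_vec_inj: "inj_on (amplitude_vec N A) Z"
    and full_rank:
      "\<not> module.lin_dep class_ring (module_vec TYPE(real) N) (amplitude_vec N A ` Z)"
begin

definition B :: "nat \<Rightarrow> 'a \<Rightarrow> real" where
  "B \<nu> z = \<kappa> z * A \<nu> (\<sigma> z)"

end

end

theory Submission
  imports Defs
begin

text \<open>Full rank asks only for \<open>|Z|\<close> linearly independent vectors labelled by the points of \<open>Z\<close>;
  the dual functions are computed from the amplitudes afterwards and cannot obstruct this choice.
  Since \<open>Z\<close> is finite, the standard basis of \<open>\<real>\<^sup>N\<close> with \<open>N = |Z|\<close> provides such vectors, labelled by
  an enumeration of \<open>Z\<close>: the amplitudes are then the indicator functions of the points of \<open>Z\<close>.
  The equality of the two classes follows, as a structure contains its skeleton.\<close>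

text \<open>The shift in \<open>Suc (f z)\<close> matches amplitude indices, which start at \<open>1\<close>, with the enumeration
  \<open>f\<close>, which starts at \<open>0\<close>. With it the amplitude vector at \<open>z\<close> is the unit vector number \<open>f z\<close>, so
  the image of \<open>Z\<close> is exactly the standard basis.\<close>

lemma indicator_amplitudes_full_rank:
  fixes f :: "'a \<Rightarrow> nat"
  assumes f: "bij_betw f Z {0..<N}"
  defines "A \<equiv> \<lambda>\<nu> z. if \<nu> = Suc (f z) then 1 else (0::real)"
  shows "inj_on (amplitude_vec N A) Z"
    and "\<not> module.lin_dep class_ring (module_vec TYPE(real) N) (amplitude_vec N A ` Z)"
proof -
  have f_less: "f z < N" if "z \<in> Z" for z
    using bij_betwE[OF f] that by auto
  have amplitude_unit: "amplitude_vec N A z = unit_vec N (f z)" for z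
    by (auto simp: amplitude_vec_def A_def unit_vec_def)
  show "inj_on (amplitude_vec N A) Z"
  proof (rule inj_onI)
    fix x y assume "x \<in> Z" "y \<in> Z" "amplitude_vec N A x = amplitude_vec N A y"
    then have "f x = f y"
      using f_less by (simp add: amplitude_unit)
    with \<open>x \<in> Z\<close> \<open>y \<in> Z\<close> show "x = y"
      using bij_betw_imp_inj_on[OF f] by (auto dest: inj_onD)
  qed
  interpret vec_space "TYPE(real)" N .
  have "amplitude_vec N A ` Z = unit_vec N ` f ` Z"
    by (simp add: amplitude_unit image_image)
  also have "\<dots> = set (unit_vecs N)"
    using bij_betw_imp_surj_on[OF f] by (simp add: unit_vecs_def)
  finally show "\<not> lin_dep (amplitude_vec N A ` Z)"
    using unit_vecs_basis by (simp add: basis_def)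
qed

theorem proposition2p4:
  shows "(\<forall>(Z :: 'a set) \<sigma> \<kappa>. weighted_dual_skeleton Z \<sigma> \<kappa> \<longrightarrow>
            (\<exists>N A. complete_spectral_duality_structure Z \<sigma> \<kappa> N A)) \<and>
         {(Z :: 'a set, \<sigma>, \<kappa>). \<exists>N A. complete_spectral_duality_structure Z \<sigma> \<kappa> N A} =
         {(Z, \<sigma>, \<kappa>). weighted_dual_skeleton Z \<sigma> \<kappa>}"
proof -
  have admits: "\<exists>N A. complete_spectral_duality_structure Z \<sigma> \<kappa> N A"
    if skeleton: "weighted_dual_skeleton Z \<sigma> \<kappa>" for Z :: "'a set" and \<sigma> \<kappa>
  proof -
    obtain f where "bij_betw f Z {0..<card Z}"
      using ex_bij_betw_finite_nat[OF weighted_dual_skeleton.finite_Z[OF skeleton]] by blast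
    from indicator_amplitudes_full_rank[OF this] show ?thesis
      using skeleton
      by (blast intro: complete_spectral_duality_structure.intro
          complete_spectral_duality_structure_axioms.intro)
  qed
  then show ?thesis
    by (auto dest: complete_spectral_duality_structure.axioms(1))
qed

end
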